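(* Let $\mathfrak{h}$ be a 6-dimensional real Lie algebra endowed with a symplectic half-flat $\mathrm{SU}(3)$-structure $(\omega,\psi_+)$. Let $D$ be a derivation of $\mathfrak{h}$ such that, with respect to a basis $\{e_1,\dots,e_6\}$ of $\mathfrak{h}$ in which $\omega,\psi_+,\psi_-$ have the canonical expression, the matrix of $D$ is the real representation $\rho(A)$ of some $A\in\mathfrak{sl}(3,\mathbb{C})$. Then the 7-dimensional Lie algebra $\mathfrak{g}=\mathfrak{h}\oplus_D\mathbb{R}\xi$ has a closed $\mathrm{G}_2$ form.
   Context: Notation: for a basis $\{e_i\}$ of a Lie algebra with dual basis $\{e^i\}$, $e^{ij}=e^i\wedge e^j$, $e^{ijk}=e^i\wedge e^j\wedge e^k$, etc. $d$ is the Chevalley–Eilenberg differential, with $d\alpha(X,Y)=-\alpha([X,Y])$ on 1-forms. An $\mathrm{SU}(3)$-structure on a 6-dimensional real Lie algebra $\mathfrak{h}$ is given by a pair $(\omega,\psi_+)\in\Lambda^2\mathfrak{h}^*\times\Lambda^3\mathfrak{h}^*$ for which there is a basis $\{e_1,\dots,e_6\}$ of $\mathfrak{h}$ (orthonormal for the associated metric) in which $\omega=e^{12}+e^{34}+e^{56}$, $\psi_+=e^{135}-e^{146}-e^{236}-e^{245}$; the pair determines $\psi_-=e^{136}+e^{145}+e^{235}-e^{246}$, so that $\psi_++i\psi_-=(e^1+ie^2)\wedge(e^3+ie^4)\wedge(e^5+ie^6)$. These formulas are "the canonical expression" of $\omega,\psi_+,\psi_-$. The structure is symplectic half-flat if $d\omega=0$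 and $d\psi_+=0$. Real representation: $\rho:\mathfrak{gl}(3,\mathbb{C})\to\mathfrak{gl}(6,\mathbb{R})$ sends $A=(A_{ij})$ to the block matrix $(B_{ij})_{i,j=1}^3$ with $2\times2$ blocks $B_{ij}=\begin{pmatrix}\mathrm{Re}A_{ij}&\mathrm{Im}A_{ij}\\-\mathrm{Im}A_{ij}&\mathrm{Re}A_{ij}\end{pmatrix}$. $\mathfrak{sl}(3,\mathbb{C})$ denotes the trace-free complex $3\times3$ matrices. For a derivation $D$ of $\mathfrak{h}$, $\mathfrak{h}\oplus_D\mathbb{R}\xi$ is the vector space $\mathfrak{h}\oplus\mathbb{R}\xi$ with bracket extending that of $\mathfrak{h}$ and $[\xi,U]=D(U)$ for $U\in\mathfrak{h}$. A $\mathrm{G}_2$ form on a 7-dimensional real Lie algebra $\mathfrak{g}$ is a 3-form $\varphi$ which, with respect to some basis $\{e^1,\dots,e^7\}$ of $\mathfrak{g}^*$, can be written as $\varphi=e^{127}+e^{347}+e^{567}+e^{135}-e^{146}-e^{236}-e^{245}$. It is closed if $d\varphi=0$. *)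

theory Defs
  imports "HOL-Analysis.Analysis"
begin

locale real_lie_algebra =
  fixes br :: "'a::real_vector \<Rightarrow> 'a \<Rightarrow> 'a"
  assumes linear_left: "linear (\<lambda>x. br x y)"
    and linear_right: "linear (br x)"
    and alternating: "br x x = 0"
    and jacobi: "br x (br y z) + br y (br z x) + br z (br x y) = 0"

definition derivation :: "('a::real_vector \<Rightarrow> 'a \<Rightarrow> 'a) \<Rightarrow> ('a \<Rightarrow> 'a) \<Rightarrow> bool" where
  "derivation br D \<longleftrightarrow> linear D \<and> (\<forall>x y. D (br x y) = br (D x) y + br x (D y))"

text \<open>The bracket of \<open>\<hh> \<oplus>\<^sub>D \<real>\<xi>\<close>, where \<open>(U, s)\<close> stands for \<open>U + s \<xi>\<close>.\<close>

definition semidirect_bracket ::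
  "('a::real_vector \<Rightarrow> 'a \<Rightarrow> 'a) \<Rightarrow> ('a \<Rightarrow> 'a) \<Rightarrow> 'a \<times> real \<Rightarrow> 'a \<times> real \<Rightarrow> 'a \<times> real" where
  "semidirect_bracket br D X Y =
    (br (fst X) (fst Y) + snd X *\<^sub>R D (fst Y) - snd Y *\<^sub>R D (fst X), 0)"

text \<open>A \<open>k\<close>-form is a function of the list of its \<open>k\<close> arguments. It is required to vanish on
  lists of any other length, so that equality of forms is equality of functions.\<close>

definition alt_forms :: "nat \<Rightarrow> ('a::real_vector list \<Rightarrow> real) set" where
  "alt_forms k = {\<alpha>.
     (\<forall>X. length X \<noteq> k \<longrightarrow> \<alpha> X = 0) \<and>
     (\<forall>X i. length X = k \<longrightarrow> i < k \<longrightarrow> linear (\<lambda>v. \<alpha> (X[i := v]))) \<and>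
     (\<forall>X i j. length X = k \<longrightarrow> i < j \<longrightarrow> j < k \<longrightarrow> X ! i = X ! j \<longrightarrow> \<alpha> X = 0)}"

text \<open>The wedge product of 1-forms, in the convention
  \<open>(\<alpha>\<^sub>1 \<and> \<dots> \<and> \<alpha>\<^sub>k)(X\<^sub>1, \<dots>, X\<^sub>k) = det (\<alpha>\<^sub>i(X\<^sub>j))\<close>.\<close>

definition wedge :: "('a \<Rightarrow> real) list \<Rightarrow> 'a list \<Rightarrow> real" where
  "wedge as X =
    (if length X = length as
     then \<Sum>\<sigma> | \<sigma> permutes {..<length as}.
            of_int (sign \<sigma>) * (\<Prod>i<length as. (as ! i) (X ! \<sigma> i))
     else 0)"

text \<open>The Chevalley--Eilenberg differential
  \<open>d\<alpha>(X\<^sub>0, \<dots>, X\<^sub>k) = \<Sum>\<^bsub>i<j\<^esub> (-1)\<^bsup>i+j\<^esup> \<alpha>([X\<^sub>i, X\<^sub>j], X\<^sub>0, \<dots>, X\<^sub>k)\<close>, with \<open>X\<^sub>i\<close> and \<open>X\<^sub>j\<close> omitted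
  after the bracket. The degree of \<open>\<alpha>\<close> need not be passed: if \<open>\<alpha>\<close> vanishes off lists of length
  \<open>k\<close>, then \<open>d\<alpha>\<close> vanishes off lists of length \<open>k + 1\<close>.\<close>

definition ce_d ::
  "('a \<Rightarrow> 'a \<Rightarrow> 'a) \<Rightarrow> ('a list \<Rightarrow> real) \<Rightarrow> 'a list \<Rightarrow> real" where
  "ce_d br \<alpha> X =
    (\<Sum>j<length X. \<Sum>i<j. (-1) ^ (i + j) * \<alpha> (br (X ! i) (X ! j) # nths X (- {i, j})))"

lemma ce_d_one_form: "ce_d br \<alpha> [x, y] = - \<alpha> [br x y]"
  by (simp add: ce_d_def nths_Cons numeral_2_eq_2)

definition is_closed :: "('a \<Rightarrow> 'a \<Rightarrow> 'a) \<Rightarrow> ('a list \<Rightarrow> real) \<Rightarrow> bool" where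
  "is_closed br \<alpha> \<longleftrightarrow> (\<forall>X. ce_d br \<alpha> X = 0)"

text \<open>Frames and coframes are indexed by \<open>1, \<dots>, n\<close>; their values at other indices are irrelevant.\<close>

definition is_frame :: "nat \<Rightarrow> (nat \<Rightarrow> 'a::real_vector) \<Rightarrow> bool" where
  "is_frame n e \<longleftrightarrow> inj_on e {1..n} \<and> independent (e ` {1..n}) \<and> span (e ` {1..n}) = UNIV"

definition dual_frame :: "nat \<Rightarrow> (nat \<Rightarrow> 'a::real_vector) \<Rightarrow> nat \<Rightarrow> 'a \<Rightarrow> real" where
  "dual_frame n e i v = representation (e ` {1..n}) v (e i)"

text \<open>\<open>\<epsilon>\<close> is a basis of the dual space.\<close>

definition is_coframe :: "nat \<Rightarrow> (nat \<Rightarrow> 'a::real_vector \<Rightarrow> real) \<Rightarrow> bool" where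
  "is_coframe n \<epsilon> \<longleftrightarrow>
     (\<forall>i\<in>{1..n}. linear (\<epsilon> i)) \<and>
     (\<forall>c :: nat \<Rightarrow> real. (\<forall>v. (\<Sum>i=1..n. c i * \<epsilon> i v) = 0) \<longrightarrow> (\<forall>i\<in>{1..n}. c i = 0)) \<and>
     (\<forall>f :: 'a \<Rightarrow> real. linear f \<longrightarrow> (\<exists>c :: nat \<Rightarrow> real. \<forall>v. f v = (\<Sum>i=1..n. c i * \<epsilon> i v)))"

text \<open>\<open>coform \<epsilon> [i, j, \<dots>]\<close> is \<open>\<epsilon>\<^bsup>ij\<dots>\<^esup>\<close>.\<close>

abbreviation coform :: "(nat \<Rightarrow> 'a \<Rightarrow> real) \<Rightarrow> nat list \<Rightarrow> 'a list \<Rightarrow> real" where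
  "coform \<epsilon> is \<equiv> wedge (map \<epsilon> is)"

definition canonical_omega :: "(nat \<Rightarrow> 'a \<Rightarrow> real) \<Rightarrow> 'a list \<Rightarrow> real" where
  "canonical_omega \<epsilon> = (\<lambda>X. coform \<epsilon> [1,2] X + coform \<epsilon> [3,4] X + coform \<epsilon> [5,6] X)"

definition canonical_psi_plus :: "(nat \<Rightarrow> 'a \<Rightarrow> real) \<Rightarrow> 'a list \<Rightarrow> real" where
  "canonical_psi_plus \<epsilon> = (\<lambda>X. coform \<epsilon> [1,3,5] X - coform \<epsilon> [1,4,6] X
     - coform \<epsilon> [2,3,6] X - coform \<epsilon> [2,4,5] X)"

definition canonical_psi_minus :: "(nat \<Rightarrow> 'a \<Rightarrow> real) \<Rightarrow> 'a list \<Rightarrow> real" where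
  "canonical_psi_minus \<epsilon> = (\<lambda>X. coform \<epsilon> [1,3,6] X + coform \<epsilon> [1,4,5] X
     + coform \<epsilon> [2,3,5] X - coform \<epsilon> [2,4,6] X)"

definition canonical_phi :: "(nat \<Rightarrow> 'a \<Rightarrow> real) \<Rightarrow> 'a list \<Rightarrow> real" where
  "canonical_phi \<epsilon> = (\<lambda>X. coform \<epsilon> [1,2,7] X + coform \<epsilon> [3,4,7] X + coform \<epsilon> [5,6,7] X
     + coform \<epsilon> [1,3,5] X - coform \<epsilon> [1,4,6] X - coform \<epsilon> [2,3,6] X - coform \<epsilon> [2,4,5] X)"

definition su3_adapted ::
  "(nat \<Rightarrow> 'a::real_vector) \<Rightarrow> ('a list \<Rightarrow> real) \<Rightarrow> ('a list \<Rightarrow> real) \<Rightarrow> bool" where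
  "su3_adapted e \<omega> \<psi>p \<longleftrightarrow> is_frame 6 e \<and>
     \<omega> = canonical_omega (dual_frame 6 e) \<and> \<psi>p = canonical_psi_plus (dual_frame 6 e)"

definition SU3_structure ::
  "('a::real_vector list \<Rightarrow> real) \<Rightarrow> ('a list \<Rightarrow> real) \<Rightarrow> bool" where
  "SU3_structure \<omega> \<psi>p \<longleftrightarrow>
     \<omega> \<in> alt_forms 2 \<and> \<psi>p \<in> alt_forms 3 \<and> (\<exists>e. su3_adapted e \<omega> \<psi>p)"

text \<open>\<open>\<psi>m\<close> is the 3-form \<open>\<psi>\<^sub>-\<close> determined by the pair \<open>(\<omega>, \<psi>\<^sub>+)\<close>. Mathematically it does not depend
  on the adapted frame; a relation is used so that no statement relies on this fact.\<close>

definition is_psi_minus ::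
  "('a::real_vector list \<Rightarrow> real) \<Rightarrow> ('a list \<Rightarrow> real) \<Rightarrow> ('a list \<Rightarrow> real) \<Rightarrow> bool" where
  "is_psi_minus \<omega> \<psi>p \<psi>m \<longleftrightarrow>
     (\<exists>e. su3_adapted e \<omega> \<psi>p \<and> \<psi>m = canonical_psi_minus (dual_frame 6 e))"

definition symplectic_half_flat ::
  "('a::real_vector \<Rightarrow> 'a \<Rightarrow> 'a) \<Rightarrow> ('a list \<Rightarrow> real) \<Rightarrow> ('a list \<Rightarrow> real) \<Rightarrow> bool" where
  "symplectic_half_flat br \<omega> \<psi>p \<longleftrightarrow>
     SU3_structure \<omega> \<psi>p \<and> is_closed br \<omega> \<and> is_closed br \<psi>p"

text \<open>The \<open>(p, q)\<close> entry of \<open>\<rho>(A)\<close> for \<open>p, q \<in> {1..6}\<close>; it lies in the block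
  \<open>(\<lceil>p/2\<rceil>, \<lceil>q/2\<rceil>)\<close>, with \<open>p\<close> odd for the first row of that block. In the index type \<open>3\<close>, whose
  elements are \<open>1\<close>, \<open>2\<close> and \<open>3\<close>, \<open>of_nat\<close> is injective on \<open>{1..3}\<close>.\<close>

definition real_rep :: "complex^3^3 \<Rightarrow> nat \<Rightarrow> nat \<Rightarrow> real" where
  "real_rep A p q =
    (let a = A $ of_nat ((p + 1) div 2) $ of_nat ((q + 1) div 2) in
     if odd p then (if odd q then Re a else Im a)
     else (if odd q then - Im a else Re a))"

definition sl3 :: "(complex^3^3) set" where
  "sl3 = {A. trace A = 0}"

text \<open>The \<open>q\<close>-th column of the matrix consists of the coordinates of \<open>D e\<^sub>q\<close>.\<close>

definition frame_matrix ::
  "nat \<Rightarrow> (nat \<Rightarrow> 'a::real_vector) \<Rightarrow> ('a \<Rightarrow> 'a) \<Rightarrow> nat \<Rightarrow> nat \<Rightarrow> real" where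
  "frame_matrix n e D p q = dual_frame n e p (D (e q))"

definition G2_form :: "('a::real_vector list \<Rightarrow> real) \<Rightarrow> bool" where
  "G2_form \<phi> \<longleftrightarrow> \<phi> \<in> alt_forms 3 \<and> (\<exists>\<epsilon>. is_coframe 7 \<epsilon> \<and> \<phi> = canonical_phi \<epsilon>)"

end

theory Submission
  imports Defs
begin

text \<open>The form is \<open>\<phi> = \<omega> \<and> \<eta> + \<psi>\<^sub>+\<close>, where \<open>\<eta>\<close> is the projection to \<open>\<real>\<xi>\<close>. Since \<open>d\<eta> = 0\<close>, all
  \<open>D\<close>-dependent terms of \<open>d(\<omega> \<and> \<eta>)\<close> contain \<open>\<eta> \<and> \<eta>\<close> and vanish, so \<open>d\<phi> = 0\<close> reduces to
  \<open>d\<omega> = 0\<close>, \<open>d\<psi>\<^sub>+ = 0\<close> and the invariance of \<open>\<psi>\<^sub>+\<close> under \<open>D\<close>. The latter holds because \<open>D\<close> acts on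
  the complex coordinates \<open>e\<^sup>1 + ie\<^sup>2\<close>, \<open>e\<^sup>3 + ie\<^sup>4\<close>, \<open>e\<^sup>5 + ie\<^sup>6\<close> through the conjugate of \<open>A\<close>, and hence
  on the complex volume form \<open>\<psi>\<^sub>+ + i\<psi>\<^sub>-\<close> as multiplication by the conjugate of its trace.\<close>

section \<open>Wedge products and alternating forms\<close>

lemma wedge_2: "wedge [a, b] [x, y] = a x * b y - a y * b x"
proof -
  \<comment> \<open>Nested insertions let \<open>sum_over_permutations_insert\<close> remove one
    index at a time.\<close>
  have I: "{..<Suc (Suc 0)} = insert 1 (insert 0 {})"
    by auto
  show ?thesis
    unfolding wedge_def
    apply (simp add: I)
    apply (subst sum_over_permutations_insert, simp, simp)+
    apply (simp add: sign_swap_id sign_id permutes_sing sign_compose permutation_swap_id)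
    done
qed

lemma wedge_3:
  "wedge [a, b, c] [x, y, z] =
    a x * (b y * c z - b z * c y) - a y * (b x * c z - b z * c x) + a z * (b x * c y - b y * c x)"
proof -
  have I: "{..<Suc (Suc (Suc 0))} = insert 2 (insert 1 (insert 0 {}))"
    by auto
  show ?thesis
    unfolding wedge_def
    apply (simp add: I)
    apply (subst sum_over_permutations_insert, simp, simp)+
    apply (simp add: sign_swap_id sign_id permutes_sing sign_compose permutation_swap_id permutation_compose)
    apply (simp add: transpose_def algebra_simps)
    done
qed

lemma alt_forms_add:
  assumes "\<alpha> \<in> alt_forms k" "\<beta> \<in> alt_forms k"
  shows "(\<lambda>X. \<alpha> X + \<beta> X) \<in> alt_forms k"
  using assms unfolding alt_forms_def by (auto intro: linear_compose_add)

lemma alt_forms_diff: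
  assumes "\<alpha> \<in> alt_forms k" "\<beta> \<in> alt_forms k"
  shows "(\<lambda>X. \<alpha> X - \<beta> X) \<in> alt_forms k"
  using assms unfolding alt_forms_def by (auto intro: linear_compose_sub)

lemma length_3_cases:
  assumes "length X = 3"
  obtains x y z where "X = [x, y, z]"
  using assms by (auto simp: numeral_3_eq_3 length_Suc_conv)

lemma wedge_3_alt_forms:
  assumes "linear a" "linear b" "linear c"
  shows "wedge [a, b, c] \<in> alt_forms 3"
proof -
  interpret a: linear a by fact
  interpret b: linear b by fact
  interpret c: linear c by fact
  have "linear (\<lambda>v. wedge [a, b, c] (X[i := v]))" if X: "length X = 3" and i: "i < 3" for X i
  proof -
    obtain x y z where "X = [x, y, z]"
      using X by (rule length_3_cases)
    moreover have "i = 0 \<or> i = 1 \<or> i = 2"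
      using i by auto
    ultimately show ?thesis
      by (auto simp: wedge_3 a.add b.add c.add a.scale b.scale c.scale algebra_simps
          intro!: linearI)
  qed
  moreover have "wedge [a, b, c] X = 0"
    if X: "length X = 3" and ij: "i < j" "j < 3" and eq: "X ! i = X ! j" for X i j
  proof -
    obtain x y z where "X = [x, y, z]"
      using X by (rule length_3_cases)
    moreover have "i = 0 \<and> j = 1 \<or> i = 0 \<and> j = 2 \<or> i = 1 \<and> j = 2"
      using ij by auto
    ultimately show ?thesis
      using eq by (auto simp: wedge_3 algebra_simps)
  qed
  ultimately show ?thesis
    unfolding alt_forms_def by (auto simp: wedge_def)
qed

text \<open>Vanishing on equal arguments gives skew-symmetry by polarisation at
  \<open>x + y\<close>. Linearity is recorded in the first slot because \<open>ce_d\<close> always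
  places the bracket there.\<close>

lemma alt_forms_2D:
  assumes "\<omega> \<in> alt_forms 2"
  shows "linear (\<lambda>v. \<omega> [v, y])" "\<omega> [x, y] = - \<omega> [y, x]"
proof -
  have L: "linear (\<lambda>v. \<omega> (X[i := v]))" if "length X = 2" "i < 2" for X i
    using assms that unfolding alt_forms_def by blast
  have 1: "linear (\<lambda>v. \<omega> [v, y])" for y
    using L[of "[y, y]" 0] by simp
  show "linear (\<lambda>v. \<omega> [v, y])"
    by (rule 1)
  have 2: "linear (\<lambda>v. \<omega> [y, v])" for y
    using L[of "[y, y]" 1] by simp
  have alt: "\<omega> [v, v] = 0" for v
  proof -
    have "\<omega> X = 0" if "length X = 2" "i < j" "j < 2" "X ! i = X ! j" for X i j
      using assms that unfolding alt_forms_def by blast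
    from this[of "[v, v]" 0 1] show ?thesis
      by simp
  qed
  have "\<omega> [x + y, x + y] = \<omega> [x, x] + \<omega> [x, y] + (\<omega> [y, x] + \<omega> [y, y])"
    using linear_add[OF 1] linear_add[OF 2] by simp
  then show "\<omega> [x, y] = - \<omega> [y, x]"
    by (simp add: alt)
qed

lemma alt_forms_3D:
  assumes "\<psi> \<in> alt_forms 3"
  shows "linear (\<lambda>v. \<psi> [v, y, z])" "\<psi> [x, y, z] = - \<psi> [y, x, z]" "\<psi> [x, y, z] = - \<psi> [x, z, y]"
proof -
  have L: "linear (\<lambda>v. \<psi> (X[i := v]))" if "length X = 3" "i < 3" for X i
    using assms that unfolding alt_forms_def by blast
  have A: "\<psi> X = 0" if "length X = 3" "i < j" "j < 3" "X ! i = X ! j" for X i j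
    using assms that unfolding alt_forms_def by blast
  have 1: "linear (\<lambda>v. \<psi> [v, y, z])" for y z
    using L[of "[y, y, z]" 0] by simp
  show "linear (\<lambda>v. \<psi> [v, y, z])"
    by (rule 1)
  have 2: "linear (\<lambda>v. \<psi> [y, v, z])" for y z
    using L[of "[y, y, z]" 1] by simp
  have 3: "linear (\<lambda>v. \<psi> [y, z, v])" for y z
    using L[of "[y, z, z]" 2] by simp
  have "\<psi> [x + y, x + y, z] = \<psi> [x, x, z] + \<psi> [x, y, z] + (\<psi> [y, x, z] + \<psi> [y, y, z])"
    using linear_add[OF 1] linear_add[OF 2] by simp
  then show "\<psi> [x, y, z] = - \<psi> [y, x, z]"
    using A[of "[v, v, z]" 0 1 for v] by simp
  have "\<psi> [x, y + z, y + z] = \<psi> [x, y, y] + \<psi> [x, y, z] + (\<psi> [x, z, y] + \<psi> [x, z, z])"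
    using linear_add[OF 2] linear_add[OF 3] by simp
  then show "\<psi> [x, y, z] = - \<psi> [x, z, y]"
    using A[of "[x, v, v]" 1 2 for v] by simp
qed

section \<open>Semidirect products\<close>

lemma real_lie_algebra_skew:
  assumes "real_lie_algebra br"
  shows "br x y = - br y x"
proof -
  interpret real_lie_algebra br by fact
  have "br (x + y) (x + y) = br x x + br y x + (br x y + br y y)"
    using linear_add[OF linear_left] linear_add[OF linear_right] by simp
  then have "br y x + br x y = 0"
    by (simp add: alternating)
  then show ?thesis
    by (metis add_eq_0_iff)
qed

text \<open>Expand the Jacobi sum by the number of \<xi>-components involved: with none it is the
  Jacobi identity of \<open>br\<close>, with one it is the derivation property of \<open>D\<close>,
  and with two the terms in \<open>D (D u)\<close> cancel in pairs.\<close>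

lemma real_lie_algebra_semidirect_bracket:
  assumes "real_lie_algebra br" "derivation br D"
  shows "real_lie_algebra (semidirect_bracket br D)"
proof -
  interpret real_lie_algebra br by fact
  have "linear D" and der: "\<And>x y. D (br x y) = br (D x) y + br x (D y)"
    using assms(2) by (auto simp: derivation_def)
  interpret D: linear D by fact
  note lin = D.add D.scale D.diff linear_add[OF linear_left] linear_add[OF linear_right]
    linear_scale[OF linear_left] linear_scale[OF linear_right]
    linear_diff[OF linear_left] linear_diff[OF linear_right]
  show ?thesis
  proof (rule real_lie_algebra.intro)
    fix x y z :: "'a \<times> real"
    show "linear (\<lambda>x. semidirect_bracket br D x y)"
      by (rule linearI) (auto simp: semidirect_bracket_def lin algebra_simps)
    show "linear (semidirect_bracket br D x)"
      by (rule linearI) (auto simp: semidirect_bracket_def lin algebra_simps)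
    show "semidirect_bracket br D x x = 0"
      by (simp add: semidirect_bracket_def alternating zero_prod_def)
    obtain a r b s c t where xyz: "x = (a, r)" "y = (b, s)" "z = (c, t)"
      by (metis surj_pair)
    \<comment> \<open>Solving for one term turns the Jacobi identity into a rewrite rule.\<close>
    have J: "br a (br b c) = - br b (br c a) - br c (br a b)"
      using jacobi[of a b c] by (simp only: add.assoc add_eq_0_iff2 minus_add) simp
    have sk: "br (D u) v = - br v (D u)" for u v
      by (rule real_lie_algebra_skew[OF assms(1)])
    show "semidirect_bracket br D x (semidirect_bracket br D y z) +
          semidirect_bracket br D y (semidirect_bracket br D z x) +
          semidirect_bracket br D z (semidirect_bracket br D x y) = 0"
      unfolding xyz
      by (simp add: semidirect_bracket_def lin der zero_prod_def sk J algebra_simps)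
  qed
qed

section \<open>The differential in low degrees and on the semidirect product\<close>

lemma ce_d_3:
  "ce_d br \<omega> [x, y, z] = - \<omega> [br x y, z] + \<omega> [br x z, y] - \<omega> [br y z, x]"
  by (simp add: ce_d_def nths_Cons eval_nat_numeral lessThan_Suc)

lemma ce_d_4:
  "ce_d br \<psi> [x, y, z, w] = - \<psi> [br x y, z, w] + \<psi> [br x z, y, w] - \<psi> [br y z, x, w]
    - \<psi> [br x w, y, z] + \<psi> [br y w, x, z] - \<psi> [br z w, x, y]"
  by (simp add: ce_d_def nths_Cons eval_nat_numeral lessThan_Suc)

text \<open>Bracketing merges two arguments into one, so every summand evaluates the form on a list
  shorter by one. This disposes of the lists of wrong length over which \<open>is_closed\<close>
  also quantifies.\<close>

lemma ce_d_other_length: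
  assumes "\<And>X. length X \<noteq> k \<Longrightarrow> \<alpha> X = 0" and "length X \<noteq> Suc k"
  shows "ce_d br \<alpha> X = 0"
proof -
  have "length (br (X ! i) (X ! j) # nths X (- {i, j})) \<noteq> k"
    if "j < length X" "i < j" for i j
  proof -
    have "{l. l < length X \<and> l \<in> - {i, j}} = {..<length X} - {i, j}"
      by auto
    then have "length (nths X (- {i, j})) = length X - 2"
      using that by (simp add: length_nths card_Diff_subset)
    then show ?thesis
      using that assms(2) by auto
  qed
  then show ?thesis
    using assms(1) unfolding ce_d_def by (intro sum.neutral ballI) simp
qed

text \<open>The last two hypotheses say pointwise that \<phi> = \<psi> + \<omega> \<and> \<eta>, the
  second components being the values of \<eta>. Writing D.\<psi> for the sum in \<open>inv\<close>,
  the computation is d\<phi> = d\<psi> + d\<omega> \<and> \<eta> + D.\<psi> \<and> \<eta>.\<close>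

lemma is_closed_semidirect_bracket:
  assumes "\<omega> \<in> alt_forms 2" "\<psi> \<in> alt_forms 3" "is_closed br \<omega>" "is_closed br \<psi>"
    and inv: "\<And>x y z. \<psi> [D x, y, z] + \<psi> [x, D y, z] + \<psi> [x, y, D z] = 0"
    and \<phi>_len: "\<And>X. length X \<noteq> 3 \<Longrightarrow> \<phi> X = 0"
    and \<phi>: "\<And>x y z a b c. \<phi> [(x, a), (y, b), (z, c)] =
      \<psi> [x, y, z] + \<omega> [x, y] * c - \<omega> [x, z] * b + \<omega> [y, z] * a"
  shows "is_closed (semidirect_bracket br D) \<phi>"
  unfolding is_closed_def
proof
  fix X :: "('a \<times> real) list"
  note lo = alt_forms_2D(1)[OF assms(1)] and lp = alt_forms_3D(1)[OF assms(2)]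
  note lin = linear_add[OF lo] linear_diff[OF lo] linear_scale[OF lo]
    linear_add[OF lp] linear_diff[OF lp] linear_scale[OF lp]
  have sk2: "\<omega> [x, D y] = - \<omega> [D y, x]" for x y
    by (rule alt_forms_2D(2)[OF assms(1)])
  have sk2': "\<omega> [x, br y z] = - \<omega> [br y z, x]" for x y z
    by (rule alt_forms_2D(2)[OF assms(1)])
  \<comment> \<open>Skew-symmetry moves \<open>D\<close> to the first slot, where the bracket puts
    it.\<close>
  have inv': "\<psi> [D x, y, z] - \<psi> [D y, x, z] + \<psi> [D z, x, y] = 0" for x y z
    using inv[of x y z] alt_forms_3D(2,3)[OF assms(2)] by (metis add.inverse_inverse diff_conv_add_uminus)
  have dw: "- \<omega> [br x y, z] + \<omega> [br x z, y] - \<omega> [br y z, x] = 0" for x y z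
    using assms(3) unfolding is_closed_def by (metis ce_d_3)
  have dp: "- \<psi> [br x y, z, w] + \<psi> [br x z, y, w] - \<psi> [br y z, x, w]
    - \<psi> [br x w, y, z] + \<psi> [br y w, x, z] - \<psi> [br z w, x, y] = 0" for x y z w
    using assms(4) unfolding is_closed_def by (metis ce_d_4)
  show "ce_d (semidirect_bracket br D) \<phi> X = 0"
  proof (cases "length X = 4")
    case False
    with \<phi>_len show ?thesis
      by (intro ce_d_other_length[of 3]) auto
  next
    case True
    then obtain x a y b z c w d where X: "X = [(x, a), (y, b), (z, c), (w, d)]"
      by (auto simp: eval_nat_numeral length_Suc_conv)
    \<comment> \<open>The first two rows are d\<psi>, the next four d\<omega> \<and> \<eta>, and the
      last four D.\<psi> \<and> \<eta>, each wedge with \<eta> expanded over the argument fed to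
      \<eta>.\<close>
    have "ce_d (semidirect_bracket br D) \<phi> X =
        (- \<psi> [br x y, z, w] + \<psi> [br x z, y, w] - \<psi> [br y z, x, w]
          - \<psi> [br x w, y, z] + \<psi> [br y w, x, z] - \<psi> [br z w, x, y])
        + d * (- \<omega> [br x y, z] + \<omega> [br x z, y] - \<omega> [br y z, x])
        - c * (- \<omega> [br x y, w] + \<omega> [br x w, y] - \<omega> [br y w, x])
        + b * (- \<omega> [br x z, w] + \<omega> [br x w, z] - \<omega> [br z w, x])
        - a * (- \<omega> [br y z, w] + \<omega> [br y w, z] - \<omega> [br z w, y])
        - a * (\<psi> [D y, z, w] - \<psi> [D z, y, w] + \<psi> [D w, y, z])
        + b * (\<psi> [D x, z, w] - \<psi> [D z, x, w] + \<psi> [D w, x, z])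
        - c * (\<psi> [D x, y, w] - \<psi> [D y, x, w] + \<psi> [D w, x, y])
        + d * (\<psi> [D x, y, z] - \<psi> [D y, x, z] + \<psi> [D z, x, y])"
      unfolding X ce_d_4 semidirect_bracket_def
      by (simp add: \<phi> lin sk2 sk2' algebra_simps)
    then show ?thesis
      by (simp only: dw dp inv' mult_zero_right)
  qed
qed

section \<open>Frames\<close>

lemma frame_expansion:
  assumes "is_frame n e"
  shows "(\<Sum>i=1..n. dual_frame n e i v *\<^sub>R e i) = v"
proof -
  have "(\<Sum>b\<in>e ` {1..n}. representation (e ` {1..n}) v b *\<^sub>R b) = v"
    using assms by (intro real_vector.sum_representation_eq) (auto simp: is_frame_def)
  then show ?thesis
    using assms by (simp add: is_frame_def sum.reindex dual_frame_def)
qed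

lemma linear_dual_frame:
  assumes "is_frame n e"
  shows "linear (dual_frame n e i)"
  using assms unfolding dual_frame_def is_frame_def
  by (intro linearI) (simp_all add: real_vector.representation_add real_vector.representation_scale)

lemma dual_frame_frame:
  assumes "is_frame n e" "i \<in> {1..n}" "j \<in> {1..n}"
  shows "dual_frame n e i (e j) = (if i = j then 1 else 0)"
  using assms unfolding dual_frame_def is_frame_def
  by (auto simp: real_vector.representation_basis inj_on_eq_iff)

lemma linear_frame_expansion:
  assumes "is_frame n e" "linear f"
  shows "f v = (\<Sum>i=1..n. dual_frame n e i v *\<^sub>R f (e i))"
proof -
  have "f v = f (\<Sum>i=1..n. dual_frame n e i v *\<^sub>R e i)"
    by (simp only: frame_expansion[OF assms(1)])
  also have "\<dots> = (\<Sum>i=1..n. dual_frame n e i v *\<^sub>R f (e i))"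
    by (simp add: linear_sum[OF assms(2)] linear_scale[OF assms(2)])
  finally show ?thesis .
qed

lemma is_coframe_dual_frame:
  assumes "is_frame n e"
  shows "is_coframe n (dual_frame n e)"
  unfolding is_coframe_def
proof (intro conjI allI impI ballI)
  show "linear (dual_frame n e i)" for i
    by (rule linear_dual_frame[OF assms])
next
  fix c :: "nat \<Rightarrow> real" and j
  assume "\<forall>v. (\<Sum>i=1..n. c i * dual_frame n e i v) = 0" and j: "j \<in> {1..n}"
  then have "(\<Sum>i=1..n. c i * dual_frame n e i (e j)) = 0"
    by blast
  also have "(\<Sum>i=1..n. c i * dual_frame n e i (e j)) = (\<Sum>i=1..n. if i = j then c i else 0)"
    using j by (intro sum.cong) (auto simp: dual_frame_frame[OF assms])
  finally show "c j = 0"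
    using j by simp
next
  fix f :: "'a \<Rightarrow> real"
  assume "linear f"
  then have "f v = (\<Sum>i=1..n. f (e i) * dual_frame n e i v)" for v
    by (subst linear_frame_expansion[OF assms]) (simp_all add: mult.commute)
  then show "\<exists>c. \<forall>v. f v = (\<Sum>i=1..n. c i * dual_frame n e i v)"
    by (intro exI allI)
qed

lemma dim_frame:
  fixes e :: "nat \<Rightarrow> 'a::real_vector"
  assumes "is_frame n e"
  shows "dim (UNIV :: 'a set) = n"
  using assms real_vector.dim_eq_card[of "e ` {1..n}" UNIV]
  by (simp add: is_frame_def card_image)

section \<open>Extension of a frame by \<xi>\<close>

definition extend_frame :: "nat \<Rightarrow> (nat \<Rightarrow> 'a::real_vector) \<Rightarrow> nat \<Rightarrow> 'a \<times> real" where
  "extend_frame n e i = (if i = Suc n then (0, 1) else (e i, 0))"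

lemma is_frame_extend_frame:
  assumes "is_frame n e"
  shows "is_frame (Suc n) (extend_frame n e)"
proof -
  let ?\<iota> = "\<lambda>v::'a. (v, 0::real)" and ?B = "e ` {1..n}"
  have lin: "linear ?\<iota>"
    by (rule linearI) auto
  have B: "inj_on e {1..n}" "independent ?B" "span ?B = UNIV"
    using assms by (auto simp: is_frame_def)
  have img: "extend_frame n e ` {1..Suc n} = insert (0, 1) (?\<iota> ` ?B)"
    by (auto simp: extend_frame_def image_iff atLeastAtMostSuc_conv)
  have span: "span (?\<iota> ` ?B) = range ?\<iota>"
    using linear_span_image[OF lin, of ?B] B(3) by simp
  have "independent (?\<iota> ` ?B)"
    using B(2) by (intro linear_independent_injective_image[OF lin]) (auto intro: inj_onI)
  moreover have "(0, 1) \<notin> span (?\<iota> ` ?B)"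
    unfolding span by auto
  ultimately have "independent (insert (0, 1) (?\<iota> ` ?B))"
    by (rule real_vector.independent_insertI[rotated])
  moreover have "(v, s) \<in> span (insert (0, 1) (?\<iota> ` ?B))" for v s
  proof -
    have "(v, 0) \<in> span (insert (0, 1) (?\<iota> ` ?B))"
      using span real_vector.span_mono[OF subset_insertI] by blast
    moreover have "(0, 1) \<in> span (insert (0, 1) (?\<iota> ` ?B))"
      by (simp add: real_vector.span_base)
    ultimately have "(v, 0) + s *\<^sub>R (0, 1) \<in> span (insert (0, 1) (?\<iota> ` ?B))"
      by (intro real_vector.span_add real_vector.span_scale)
    then show ?thesis
      by simp
  qed
  moreover have "inj_on (extend_frame n e) {1..Suc n}"
    by (rule inj_onI) (auto simp: extend_frame_def le_Suc_eq split: if_splits intro: inj_onD[OF B(1)])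
  ultimately show ?thesis
    unfolding is_frame_def img by (metis UNIV_eq_I surj_pair)
qed

text \<open>The right-hand side is linear in \<open>X\<close> and takes the values 0 and 1 of the
  \<open>i\<close>-th dual covector on the extended frame, so expanding it in that frame leaves one
  coordinate. This avoids computing \<open>representation\<close> in the product space.\<close>

lemma dual_frame_extend_frame:
  assumes "is_frame n e" "i \<in> {1..Suc n}"
  shows "dual_frame (Suc n) (extend_frame n e) i X =
    (if i = Suc n then snd X else dual_frame n e i (fst X))"
proof -
  let ?g = "\<lambda>X. if i = Suc n then snd X else dual_frame n e i (fst X)"
  let ?E = "dual_frame (Suc n) (extend_frame n e)"
  have lin: "linear ?g"
    using linear_dual_frame[OF assms(1)]
    by (intro linearI) (auto simp: linear_add linear_scale)
  have "?g X = (\<Sum>j=1..Suc n. ?E j X *\<^sub>R ?g (extend_frame n e j))"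
    by (rule linear_frame_expansion[OF is_frame_extend_frame[OF assms(1)] lin])
  also have "\<dots> = (\<Sum>j=1..Suc n. if j = i then ?E j X else 0)"
    using assms(2)
    by (intro sum.cong)
      (auto simp: extend_frame_def dual_frame_frame[OF assms(1)]
        linear_0[OF linear_dual_frame[OF assms(1)]])
  also have "\<dots> = ?E i X"
    using assms(2) by simp
  finally show ?thesis
    by simp
qed

section \<open>Invariance of the complex volume form\<close>

text \<open>This is the value of dz1 \<and> dz2 \<and> dz3 on three vectors with complex coordinates
  \<open>u\<close>, \<open>v\<close>, \<open>w\<close>.\<close>

definition complex_det :: "(nat \<Rightarrow> complex) \<Rightarrow> (nat \<Rightarrow> complex) \<Rightarrow> (nat \<Rightarrow> complex) \<Rightarrow> complex" where
  "complex_det u v w = u 1 * (v 2 * w 3 - v 3 * w 2) - u 2 * (v 1 * w 3 - v 3 * w 1)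
    + u 3 * (v 1 * w 2 - v 2 * w 1)"

text \<open>This is the derivative at t = 0 of det((1 + tM)u, (1 + tM)v, (1 + tM)w) = det(1 + tM)
  det(u, v, w). As a polynomial identity it can be checked by expansion.\<close>

lemma complex_det_trace:
  fixes M :: "nat \<Rightarrow> nat \<Rightarrow> complex"
  defines "T \<equiv> \<lambda>u k. M k 1 * u 1 + M k 2 * u 2 + M k 3 * u 3"
  shows "complex_det (T u) v w + complex_det u (T v) w + complex_det u v (T w)
    = (M 1 1 + M 2 2 + M 3 3) * complex_det u v w"
  unfolding complex_det_def T_def by (simp add: algebra_simps)

text \<open>Only \<open>k\<close> = 1, 2, 3 matter, so the truncated subtraction is
  harmless.\<close>

definition complex_coord :: "(nat \<Rightarrow> 'a \<Rightarrow> real) \<Rightarrow> 'a \<Rightarrow> nat \<Rightarrow> complex" where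
  "complex_coord \<epsilon> v k = Complex (\<epsilon> (2 * k - 1) v) (\<epsilon> (2 * k) v)"

text \<open>In the product of the three factors, a real term takes either no imaginary part or two
  of them; the two give i^2 = -1, whence the three minus signs.\<close>

lemma canonical_psi_plus_complex_det:
  "canonical_psi_plus \<epsilon> [u, v, w] =
    Re (complex_det (complex_coord \<epsilon> u) (complex_coord \<epsilon> v) (complex_coord \<epsilon> w))"
  by (simp add: canonical_psi_plus_def complex_det_def complex_coord_def wedge_3 algebra_simps
      flip: numeral_2_eq_2)

text \<open>A block with first row (Re a, Im a) and second row (-Im a, Re a) sends (x, y) to the
  real and imaginary parts of cnj(a)(x + iy). The placement of the minus sign is what produces the
  conjugate.\<close>

lemma complex_coord_real_rep:
  assumes e: "is_frame 6 e" and "linear D"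
    and M: "\<forall>p\<in>{1..6}. \<forall>q\<in>{1..6}. frame_matrix 6 e D p q = real_rep A p q"
    and k: "k \<in> {1, 2, 3}"
  shows "complex_coord (dual_frame 6 e) (D v) k =
    cnj (A $ of_nat k $ 1) * complex_coord (dual_frame 6 e) v 1
    + cnj (A $ of_nat k $ 2) * complex_coord (dual_frame 6 e) v 2
    + cnj (A $ of_nat k $ 3) * complex_coord (dual_frame 6 e) v 3"
proof -
  \<comment> \<open>The \<open>p\<close>-th coordinate of \<open>D v\<close> is linear in
    \<open>v\<close>, and its values on the frame are row \<open>p\<close> of the matrix.\<close>
  have D: "dual_frame 6 e p (D v) = (\<Sum>q=1..6. dual_frame 6 e q v * real_rep A p q)"
    if "p \<in> {1..6}" for p
  proof -
    have "linear (\<lambda>v. dual_frame 6 e p (D v))"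
      using linear_compose[OF \<open>linear D\<close> linear_dual_frame[OF e]] by (simp add: o_def)
    from linear_frame_expansion[OF e this, of v] show ?thesis
      using that M by (simp add: frame_matrix_def)
  qed
  have S: "(\<Sum>q=1..6. f q) = f 1 + f 2 + f 3 + f 4 + f 5 + f 6" for f :: "nat \<Rightarrow> real"
    by (simp add: eval_nat_numeral)
  show ?thesis
    using k
    by (auto simp: complex_eq_iff complex_coord_def D[unfolded S] real_rep_def Let_def algebra_simps
        simp flip: numeral_2_eq_2)
qed

lemma canonical_psi_plus_invariant:
  assumes e: "is_frame 6 e" and "linear D" and "A \<in> sl3"
    and M: "\<forall>p\<in>{1..6}. \<forall>q\<in>{1..6}. frame_matrix 6 e D p q = real_rep A p q"
  shows "canonical_psi_plus (dual_frame 6 e) [D x, y, z]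
    + canonical_psi_plus (dual_frame 6 e) [x, D y, z]
    + canonical_psi_plus (dual_frame 6 e) [x, y, D z] = 0"
proof -
  let ?Z = "complex_coord (dual_frame 6 e)"
  define N :: "nat \<Rightarrow> nat \<Rightarrow> complex" where "N k l = cnj (A $ of_nat k $ of_nat l)" for k l
  define T where "T u k = N k 1 * u 1 + N k 2 * u 2 + N k 3 * u 3" for u :: "nat \<Rightarrow> complex" and k
  have Z: "?Z (D v) k = T (?Z v) k" if "k \<in> {1, 2, 3}" for v k
    using complex_coord_real_rep[OF e \<open>linear D\<close> M that] by (simp add: T_def N_def)
  have "N 1 1 + N 2 2 + N 3 3 = cnj (trace A)"
    by (simp add: N_def trace_def sum_3)
  also have "\<dots> = 0"
    using \<open>A \<in> sl3\<close> by (simp add: sl3_def)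
  finally have tr: "N 1 1 + N 2 2 + N 3 3 = 0" .
  have "complex_det (?Z (D x)) (?Z y) (?Z z) + complex_det (?Z x) (?Z (D y)) (?Z z)
      + complex_det (?Z x) (?Z y) (?Z (D z))
    = complex_det (T (?Z x)) (?Z y) (?Z z) + complex_det (?Z x) (T (?Z y)) (?Z z)
      + complex_det (?Z x) (?Z y) (T (?Z z))"
    \<comment> \<open>\<open>complex_det\<close> reads its arguments only at 1, 2, 3, where
      \<open>Z\<close> applies.\<close>
    using Z by (simp add: complex_det_def)
  also have "\<dots> = 0"
    using complex_det_trace[of N "?Z x" "?Z y" "?Z z"] tr unfolding T_def by simp
  finally show ?thesis
    \<comment> \<open>The claim is the real part of the complex identity just proved.\<close>
    unfolding canonical_psi_plus_complex_det by (metis plus_complex.sel(1) zero_complex.sel(1))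
qed

section \<open>The closed G2 form on the extension\<close>

theorem proposition1p1:
  fixes br :: "'a::real_vector \<Rightarrow> 'a \<Rightarrow> 'a"
    and \<omega> \<psi>p \<psi>m :: "'a list \<Rightarrow> real"
    and D :: "'a \<Rightarrow> 'a"
    and e :: "nat \<Rightarrow> 'a"
    and A :: "complex^3^3"
  assumes "real_lie_algebra br"
    and "dim (UNIV :: 'a set) = 6"
    and "symplectic_half_flat br \<omega> \<psi>p"
    and "is_psi_minus \<omega> \<psi>p \<psi>m"
    and "derivation br D"
    and "su3_adapted e \<omega> \<psi>p"
    and "\<psi>m = canonical_psi_minus (dual_frame 6 e)"
    and "A \<in> sl3"
    and "\<forall>p\<in>{1..6}. \<forall>q\<in>{1..6}. frame_matrix 6 e D p q = real_rep A p q"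
  shows "real_lie_algebra (semidirect_bracket br D) \<and>
    dim (UNIV :: ('a \<times> real) set) = 7 \<and>
    (\<exists>\<phi> :: ('a \<times> real) list \<Rightarrow> real. G2_form \<phi> \<and> is_closed (semidirect_bracket br D) \<phi>)"
proof (intro conjI exI)
  let ?f = "extend_frame 6 e"
  \<comment> \<open>The seventh covector is dual to \<xi>, that is \<eta>, so the terms with index 7
    assemble to \<omega> \<and> \<eta> and the others to \<open>\<psi>p\<close>.\<close>
  let ?\<phi> = "canonical_phi (dual_frame 7 ?f)"
  have e: "is_frame 6 e" and \<omega>: "\<omega> = canonical_omega (dual_frame 6 e)"
    and \<psi>p: "\<psi>p = canonical_psi_plus (dual_frame 6 e)"
    using assms(6) by (auto simp: su3_adapted_def)
  have f: "is_frame 7 ?f"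
    using is_frame_extend_frame[OF e] by simp
  show "real_lie_algebra (semidirect_bracket br D)"
    by (rule real_lie_algebra_semidirect_bracket[OF assms(1,5)])
  show "dim (UNIV :: ('a \<times> real) set) = 7"
    by (rule dim_frame[OF f])
  have alt: "?\<phi> \<in> alt_forms 3"
    unfolding canonical_phi_def list.map
    by (intro alt_forms_add alt_forms_diff wedge_3_alt_forms linear_dual_frame[OF f])
  then show "G2_form ?\<phi>"
    using is_coframe_dual_frame[OF f] by (auto simp: G2_form_def)
  \<comment> \<open>The first six covectors are pulled back from the ideal, which lets \<phi> be
    compared with \<omega> and \<open>\<psi>p\<close> on first components.\<close>
  have d: "dual_frame 7 ?f i X = (if i = 7 then snd X else dual_frame 6 e i (fst X))"
    if "i \<in> {1..7}" for i X
    using dual_frame_extend_frame[OF e, of i X] that by simp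
  show "is_closed (semidirect_bracket br D) ?\<phi>"
  proof (rule is_closed_semidirect_bracket)
    show "\<omega> \<in> alt_forms 2" "\<psi>p \<in> alt_forms 3" "is_closed br \<omega>" "is_closed br \<psi>p"
      using assms(3) by (auto simp: symplectic_half_flat_def SU3_structure_def)
    show "\<psi>p [D x, y, z] + \<psi>p [x, D y, z] + \<psi>p [x, y, D z] = 0" for x y z
      unfolding \<psi>p using assms(5)
      by (intro canonical_psi_plus_invariant[OF e _ assms(8,9)]) (simp add: derivation_def)
    show "?\<phi> X = 0" if "length X \<noteq> 3" for X
      using alt that by (simp add: alt_forms_def)
    show "?\<phi> [(x, a), (y, b), (z, c)] =
        \<psi>p [x, y, z] + \<omega> [x, y] * c - \<omega> [x, z] * b + \<omega> [y, z] * a" for x y z a b c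
      unfolding canonical_phi_def \<omega> \<psi>p canonical_omega_def canonical_psi_plus_def
      by (simp add: wedge_2 wedge_3 d algebra_simps)
  qed
qed

end
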